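(* Let $\Pi\subset\mathbb{N}$ be the set of prime numbers listed in increasing order, and let $\widetilde{\mathcal{P}}:=\{(\mathbb{Z}/p\mathbb{Z},\tilde d_p)\;:\;p\in\Pi\}$. Then $\widetilde{\mathcal{P}}$ contains at least one subsequence of compact metric spaces $(\mathbb{Z}/p_n\mathbb{Z},\tilde d_{p_n})_{n\ge1}$, with $p_1<p_2<\cdots$ primes, that converges in the Gromov-Hausdorff sense.
   Context: For $p\in\mathbb{N}$, $p\ge 2$, each class $[n]_p\in\mathbb{Z}/p\mathbb{Z}$ has a unique representative $n_0\in[n]_p$ with $0\le n_0\le p-1$. Define $d_p([n]_p,[m]_p):=|n_0-m_0|$, a metric on $\mathbb{Z}/p\mathbb{Z}$ of diameter $p-1$, and the normalized metric $\tilde d_p:=\frac{1}{p-1}d_p$. Gromov-Hausdorff convergence is convergence with respect to the Gromov-Hausdorff distance between compact metric spaces (limits are compact metric spaces, unique up to isometry). *)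

theory Defs
  imports
    "HOL-Analysis.Analysis"
    "HOL-Algebra.IntRing"
    "HOL-Number_Theory.Cong"
begin

section \<open>Gromov-Hausdorff distance and convergence\<close>

definition isometric_embedding :: "'a metric \<Rightarrow> 'b metric \<Rightarrow> ('a \<Rightarrow> 'b) \<Rightarrow> bool" where
  "isometric_embedding X Z f \<longleftrightarrow>
     f ` mspace X \<subseteq> mspace Z \<and>
     (\<forall>x\<in>mspace X. \<forall>y\<in>mspace X. mdist Z (f x) (f y) = mdist X x y)"

definition hausdorff_dist :: "'a metric \<Rightarrow> 'a set \<Rightarrow> 'a set \<Rightarrow> real" where
  "hausdorff_dist Z A B =
     Inf {r. 0 < r \<and> A \<subseteq> (\<Union>b\<in>B. mball_of Z b r) \<and> B \<subseteq> (\<Union>a\<in>A. mball_of Z a r)}"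

definition compact_metric :: "'a metric \<Rightarrow> bool" where
  "compact_metric X \<longleftrightarrow> mspace X \<noteq> {} \<and> compact_space (mtopology_of X)"

text \<open>
  The infimum ranges over all metric spaces \<open>Z\<close> whose points lie in the sum type. This is no
  restriction, since only the points of the two images matter; see \<open>GH_dist_le\<close> below, where \<open>Z\<close>
  has an arbitrary type. As \<open>Inf\<close> on the reals is only meaningful for nonempty sets that are
  bounded below, \<open>GH_dist\<close> is used for compact nonempty spaces only.
\<close>

definition GH_dist :: "'a metric \<Rightarrow> 'b metric \<Rightarrow> real" where
  "GH_dist X Y =
     Inf {hausdorff_dist Z (f ` mspace X) (g ` mspace Y) | (Z :: ('a + 'b) metric) f g.
            isometric_embedding X Z f \<and> isometric_embedding Y Z g}"

definition GH_converges_to :: "(nat \<Rightarrow> 'a metric) \<Rightarrow> 'b metric \<Rightarrow> bool" where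
  "GH_converges_to X L \<longleftrightarrow>
     (\<forall>n. compact_metric (X n)) \<and> compact_metric L \<and> (\<lambda>n. GH_dist (X n) L) \<longlonglongrightarrow> 0"

text \<open>
  A compact metric space has at most continuum many points, so every compact limit is isometric to
  one whose points are real numbers (with an arbitrary metric); see \<open>GH_convergentI\<close> below.
\<close>

definition GH_convergent :: "(nat \<Rightarrow> 'a metric) \<Rightarrow> bool" where
  "GH_convergent X \<longleftrightarrow> (\<exists>L :: real metric. GH_converges_to X L)"

lemma isometric_embedding_imp_inj:
  assumes f: "isometric_embedding X Z f"
  shows "inj_on f (mspace X)"
proof (rule inj_onI)
  fix x y assume xy: "x \<in> mspace X" "y \<in> mspace X" "f x = f y"
  then have "f x \<in> mspace Z" "mdist X x y = mdist Z (f x) (f y)"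
    using f unfolding isometric_embedding_def by (blast, metis)
  with xy show "x = y" by (metis mdist_zero)
qed

lemma compact_metric_bounded:
  assumes "compact_metric X"
  obtains B where "B > 0" "\<And>x y. x \<in> mspace X \<Longrightarrow> y \<in> mspace X \<Longrightarrow> mdist X x y \<le> B"
proof -
  interpret Metric_space "mspace X" "mdist X" by simp
  have "mbounded (mspace X)"
    using assms compactin_imp_mbounded
    by (simp add: compact_metric_def mtopology_of_def compact_space_def)
  then show ?thesis
    using that unfolding mbounded_alt_pos by blast
qed

lemma hausdorff_dist_nonneg:
  assumes X: "compact_metric X" and Y: "compact_metric Y"
    and f: "isometric_embedding X Z f" and g: "isometric_embedding Y Z g"
  shows "0 \<le> hausdorff_dist Z (f ` mspace X) (g ` mspace Y)"
proof -
  obtain x0 y0 where x0: "x0 \<in> mspace X" and y0: "y0 \<in> mspace Y"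
    using X Y by (auto simp: compact_metric_def)
  obtain B where B: "B > 0" "\<And>x y. x \<in> mspace X \<Longrightarrow> y \<in> mspace X \<Longrightarrow> mdist X x y \<le> B"
    using compact_metric_bounded[OF X] by blast
  obtain C where C: "C > 0" "\<And>x y. x \<in> mspace Y \<Longrightarrow> y \<in> mspace Y \<Longrightarrow> mdist Y x y \<le> C"
    using compact_metric_bounded[OF Y] by blast
  define r where "r = B + C + mdist Z (f x0) (g y0) + 1"
  have fz: "f x \<in> mspace Z" if "x \<in> mspace X" for x
    using f that by (auto simp: isometric_embedding_def)
  have gz: "g x \<in> mspace Z" if "x \<in> mspace Y" for x
    using g that by (auto simp: isometric_embedding_def)
  have r: "mdist Z (f x) (g y) < r" if "x \<in> mspace X" "y \<in> mspace Y" for x y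
  proof -
    have "mdist Z (f x) (g y) \<le> mdist Z (f x) (f x0) + mdist Z (f x0) (g y0) + mdist Z (g y0) (g y)"
      using that x0 y0 fz gz mdist_triangle[of "f x" Z "f x0" "g y"]
        mdist_triangle[of "f x0" Z "g y0" "g y"] by force
    moreover have "mdist Z (f x) (f x0) \<le> B" "mdist Z (g y0) (g y) \<le> C"
      using f g that x0 y0 B C by (auto simp: isometric_embedding_def)
    ultimately show ?thesis by (simp add: r_def)
  qed
  have "f ` mspace X \<subseteq> (\<Union>b\<in>g ` mspace Y. mball_of Z b r)"
    using r y0 fz gz by (fastforce simp: mdist_commute)
  moreover have "g ` mspace Y \<subseteq> (\<Union>a\<in>f ` mspace X. mball_of Z a r)"
    using r x0 fz gz by fastforce
  moreover have "0 < r" using B C by (simp add: r_def add_pos_nonneg)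
  ultimately show ?thesis
    unfolding hausdorff_dist_def by (intro cInf_greatest) auto
qed

lemma GH_dist_le:
  fixes X :: "'a metric" and Y :: "'b metric" and Z :: "'c metric"
  assumes X: "compact_metric X" and Y: "compact_metric Y"
    and f: "isometric_embedding X Z f" and g: "isometric_embedding Y Z g"
  shows "GH_dist X Y \<le> hausdorff_dist Z (f ` mspace X) (g ` mspace Y)"
proof -
  define k :: "'a + 'b \<Rightarrow> 'c" where "k = case_sum f g"
  define C where "C = Inl ` mspace X \<union> Inr ` {y \<in> mspace Y. g y \<notin> f ` mspace X}"
  define G where "G = (\<lambda>y. if g y \<in> f ` mspace X then Inl (inv_into (mspace X) f (g y)) else Inr y)"
  define W where "W = metric (C, \<lambda>u v. mdist Z (k u) (k v))"
  have fz: "f x \<in> mspace Z" if "x \<in> mspace X" for x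
    using f that by (auto simp: isometric_embedding_def)
  have gz: "g x \<in> mspace Z" if "x \<in> mspace Y" for x
    using g that by (auto simp: isometric_embedding_def)
  have injf: "inj_on f (mspace X)"
    by (rule isometric_embedding_imp_inj[OF f])
  have injg: "inj_on g (mspace Y)"
    by (rule isometric_embedding_imp_inj[OF g])
  have kC: "k u \<in> mspace Z" if "u \<in> C" for u
    using that fz gz by (auto simp: C_def k_def)
  have injk: "inj_on k C"
    using injf injg unfolding inj_on_def C_def k_def by (auto simp: image_iff split: sum.splits)
  interpret W: Metric_space C "\<lambda>u v. mdist Z (k u) (k v)"
    by unfold_locales (use kC injk in \<open>auto simp: mdist_commute mdist_triangle inj_on_eq_iff\<close>)
  have W: "mspace W = C" "mdist W = (\<lambda>u v. mdist Z (k u) (k v))"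
    by (simp_all add: W_def)
  have GC: "G y \<in> C" if "y \<in> mspace Y" for y
    using that by (auto simp: G_def C_def intro: inv_into_into)
  have kG: "k (G y) = g y" for y
    by (auto simp: G_def k_def f_inv_into_f)
  have kI: "k (Inl x) = f x" for x by (simp add: k_def)
  have IC: "Inl x \<in> C" if "x \<in> mspace X" for x using that by (simp add: C_def)
  have "hausdorff_dist W (Inl ` mspace X) (G ` mspace Y) = hausdorff_dist Z (f ` mspace X) (g ` mspace Y)"
  proof -
    have "Inl ` mspace X \<subseteq> (\<Union>b\<in>G ` mspace Y. mball_of W b r) \<longleftrightarrow>
          f ` mspace X \<subseteq> (\<Union>b\<in>g ` mspace Y. mball_of Z b r)" for r
      by (auto simp: image_subset_iff W kG kI GC IC fz gz)
    moreover have "G ` mspace Y \<subseteq> (\<Union>a\<in>Inl ` mspace X. mball_of W a r) \<longleftrightarrow>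
          g ` mspace Y \<subseteq> (\<Union>a\<in>f ` mspace X. mball_of Z a r)" for r
      by (auto simp: image_subset_iff W kG kI GC IC fz gz)
    ultimately show ?thesis by (simp add: hausdorff_dist_def)
  qed
  moreover have "isometric_embedding X W Inl"
    using f by (auto simp: isometric_embedding_def W kI IC)
  moreover have "isometric_embedding Y W G"
    using g by (auto simp: isometric_embedding_def W kG GC)
  ultimately have "hausdorff_dist Z (f ` mspace X) (g ` mspace Y) \<in>
      {hausdorff_dist Z (f ` mspace X) (g ` mspace Y) | (Z :: ('a + 'b) metric) f g.
            isometric_embedding X Z f \<and> isometric_embedding Y Z g}"
    by (metis (mono_tags, lifting) mem_Collect_eq)
  then show ?thesis
    unfolding GH_dist_def
    by (rule cInf_lower) (auto intro!: bdd_belowI[of _ 0] hausdorff_dist_nonneg X Y)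
qed

lemma common_metric_space_exists:
  fixes X :: "'a metric" and Y :: "'b metric"
  assumes "mspace X \<noteq> {}" "mspace Y \<noteq> {}"
  shows "\<exists>(Z :: ('a + 'b) metric) f g. isometric_embedding X Z f \<and> isometric_embedding Y Z g"
proof -
  obtain x0 y0 where x0: "x0 \<in> mspace X" and y0: "y0 \<in> mspace Y"
    using assms by auto
  define d :: "'a + 'b \<Rightarrow> 'a + 'b \<Rightarrow> real" where
    "d u v = (case (u, v) of
        (Inl x, Inl x') \<Rightarrow> mdist X x x'
      | (Inr y, Inr y') \<Rightarrow> mdist Y y y'
      | (Inl x, Inr y) \<Rightarrow> mdist X x x0 + 1 + mdist Y y y0
      | (Inr y, Inl x) \<Rightarrow> mdist X x x0 + 1 + mdist Y y y0)" for u v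
  define C where "C = Inl ` mspace X \<union> Inr ` mspace Y"
  have pos: "mdist X x x0 + 1 + mdist Y y y0 > 0" for x y
    by (simp add: add_nonneg_pos add_pos_nonneg)
  interpret Metric_space C d
  proof
    show "0 \<le> d u v" for u v
      by (auto simp: d_def split: sum.splits)
    show "d u v = d v u" for u v
      by (auto simp: d_def mdist_commute split: sum.splits)
    show "d u v = 0 \<longleftrightarrow> u = v" if "u \<in> C" "v \<in> C" for u v
      using that pos[THEN less_imp_neq] by (cases u; cases v) (auto simp: d_def C_def)
    show "d u w \<le> d u v + d v w" if "u \<in> C" "v \<in> C" "w \<in> C" for u v w
    proof -
      have tX: "mdist X a c \<le> mdist X a b + mdist X b c" "mdist X a c \<le> mdist X a b + mdist X c b"
        if "a \<in> mspace X" "b \<in> mspace X" "c \<in> mspace X" for a b c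
        using that mdist_triangle[of a X b c] by (simp_all add: mdist_commute[of X c b])
      have tY: "mdist Y a c \<le> mdist Y a b + mdist Y b c" "mdist Y a c \<le> mdist Y a b + mdist Y c b"
        if "a \<in> mspace Y" "b \<in> mspace Y" "c \<in> mspace Y" for a b c
        using that mdist_triangle[of a Y b c] by (simp_all add: mdist_commute[of Y c b])
      have nn: "mdist X a b \<ge> 0" "mdist Y a' b' \<ge> 0" for a b a' b' by simp_all
      show ?thesis
      proof (cases u; cases v; cases w)
        fix a b c assume *: "u = Inl a" "v = Inl b" "w = Inl c"
        then show ?thesis using that tX(1)[of a b c] by (auto simp: d_def C_def)
      next
        fix a b c assume *: "u = Inl a" "v = Inl b" "w = Inr c"
        then show ?thesis using that tX(1)[of a b x0] x0 by (auto simp: d_def C_def)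
      next
        fix a b c assume *: "u = Inl a" "v = Inr b" "w = Inl c"
        then show ?thesis using that tX(2)[of a x0 c] x0 nn(2)[where a'=b and b'=y0] by (auto simp: d_def C_def simp del: mdist_nonneg)
      next
        fix a b c assume *: "u = Inl a" "v = Inr b" "w = Inr c"
        then show ?thesis using that tY(1)[of c b y0] y0 mdist_commute[of Y b c]
          by (auto simp: d_def C_def)
      next
        fix a b c assume *: "u = Inr a" "v = Inl b" "w = Inl c"
        then show ?thesis using that tX(1)[of c b x0] x0 mdist_commute[of X b c]
          by (auto simp: d_def C_def)
      next
        fix a b c assume *: "u = Inr a" "v = Inl b" "w = Inr c"
        then show ?thesis using that tY(2)[of a y0 c] y0 nn(1)[where a=b and b=x0] by (auto simp: d_def C_def simp del: mdist_nonneg)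
      next
        fix a b c assume *: "u = Inr a" "v = Inr b" "w = Inl c"
        then show ?thesis using that tY(1)[of a b y0] y0 by (auto simp: d_def C_def)
      next
        fix a b c assume *: "u = Inr a" "v = Inr b" "w = Inr c"
        then show ?thesis using that tY(1)[of a b c] by (auto simp: d_def C_def)
      qed
    qed
  qed
  have "isometric_embedding X (metric (C, d)) Inl" "isometric_embedding Y (metric (C, d)) Inr"
    by (auto simp: isometric_embedding_def C_def[symmetric]) (auto simp: C_def d_def)
  then show ?thesis by blast
qed

lemma GH_dist_nonneg:
  fixes X :: "'a metric" and Y :: "'b metric"
  assumes "compact_metric X" "compact_metric Y"
  shows "0 \<le> GH_dist X Y"
  unfolding GH_dist_def
proof (rule cInf_greatest)
  have "mspace X \<noteq> {}" "mspace Y \<noteq> {}"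
    using assms by (simp_all add: compact_metric_def)
  then obtain Z :: "('a + 'b) metric" and f g where
    "isometric_embedding X Z f" "isometric_embedding Y Z g"
    using common_metric_space_exists[of X Y] by metis
  then show "{hausdorff_dist Z (f ` mspace X) (g ` mspace Y) | (Z :: ('a + 'b) metric) f g.
      isometric_embedding X Z f \<and> isometric_embedding Y Z g} \<noteq> {}"
    by blast
qed (use hausdorff_dist_nonneg[OF assms] in blast)

lemma compact_metric_inj_real:
  fixes L :: "'c metric"
  assumes L: "compact_metric L"
  obtains h :: "'c \<Rightarrow> real" where "inj_on h (mspace L)"
proof -
  interpret Metric_space "mspace L" "mdist L" by simp
  have tb: "mtotally_bounded (mspace L)"
    using L compactin_imp_mtotally_bounded
    by (simp add: compact_metric_def mtopology_of_def compact_space_def)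
  have "\<exists>K. finite K \<and> K \<subseteq> mspace L \<and> mspace L \<subseteq> (\<Union>x\<in>K. mball x (1 / real (Suc m)))" for m
    using tb by (simp add: mtotally_bounded_def)
  then obtain K where K: "\<And>m. finite (K m)" "\<And>m. K m \<subseteq> mspace L"
      "\<And>m. mspace L \<subseteq> (\<Union>x\<in>K m. mball x (1 / real (Suc m)))"
    by metis
  define D where "D = (\<Union>m. K m)"
  have D: "countable D" "D \<subseteq> mspace L"
    using K by (auto simp: D_def countable_finite)
  define S where "S x = {(n, m). mdist L x (from_nat_into D n) < 1 / real (Suc m)}" for x
  have inj: "inj_on S (mspace L)"
  proof (rule inj_onI, rule ccontr)
    fix x y assume x: "x \<in> mspace L" and y: "y \<in> mspace L" and S: "S x = S y" and "x \<noteq> y"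
    then have "mdist L x y > 0" by simp
    then obtain m where m: "2 / real (Suc m) < mdist L x y"
      using reals_Archimedean[of "mdist L x y / 2"] by (auto simp: field_simps inverse_eq_divide)
    have "x \<in> (\<Union>q\<in>K m. mball q (1 / real (Suc m)))" using K(3) x by blast
    then obtain q where q: "q \<in> K m" "mdist L q x < 1 / real (Suc m)"
      unfolding UN_iff in_mball by blast
    then have q: "q \<in> D" "mdist L x q < 1 / real (Suc m)"
      by (auto simp: D_def mdist_commute)
    obtain n where n: "from_nat_into D n = q"
      using D q by (metis from_nat_into_surj)
    have "(n, m) \<in> S x" using q n by (simp add: S_def)
    then have "mdist L y q < 1 / real (Suc m)" using S n by (auto simp: S_def)
    then have "mdist L x y < 2 / real (Suc m)"
      using q D x y mdist_triangle[of x L q y] mdist_commute[of L q y] 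
      by (smt (verit) add_divide_distrib one_add_one subsetD)
    with m show False by simp
  qed
  obtain j :: "nat set \<Rightarrow> real" where j: "inj j"
    using nat_sets_eqpoll_reals by (auto simp: eqpoll_def bij_betw_def)
  have "inj_on (j \<circ> image prod_encode \<circ> S) (mspace L)"
    using inj j inj_prod_encode
    by (intro comp_inj_on) (auto simp: inj_on_def inj_image_eq_iff)
  then show ?thesis
    by (rule that)
qed

lemma GH_convergentI:
  fixes X :: "nat \<Rightarrow> 'b metric" and L :: "'c metric"
  assumes "GH_converges_to X L"
  shows "GH_convergent X"
proof -
  have X: "\<And>n. compact_metric (X n)" and L: "compact_metric L"
    and lim: "(\<lambda>n. GH_dist (X n) L) \<longlonglongrightarrow> 0"
    using assms by (auto simp: GH_converges_to_def)
  obtain h :: "'c \<Rightarrow> real" where h: "inj_on h (mspace L)"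
    using compact_metric_inj_real[OF L] .
  define k where "k = inv_into (mspace L) h"
  have kh: "k (h x) = x" if "x \<in> mspace L" for x
    using that h by (simp add: k_def)
  define L' where "L' = metric (h ` mspace L, \<lambda>u v. mdist L (k u) (k v))"
  interpret M: Metric_space "h ` mspace L" "\<lambda>u v. mdist L (k u) (k v)"
    by unfold_locales (auto simp: kh mdist_commute mdist_triangle inj_on_eq_iff[OF h])
  have L': "mspace L' = h ` mspace L" "mdist L' = (\<lambda>u v. mdist L (k u) (k v))"
    by (simp_all add: L'_def)
  interpret Metric_space12 "mspace L" "mdist L" "mspace L'" "mdist L'"
    by (simp add: Metric_space12_def)
  have "homeomorphic_map (mtopology_of L) (mtopology_of L') h"
    unfolding mtopology_of_def
    by (rule isometry_imp_homeomorphic_map) (auto simp: L' kh)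
  then have "mtopology_of L homeomorphic_space mtopology_of L'"
    by (rule homeomorphic_map_imp_homeomorphic_space)
  then have cL': "compact_metric L'"
    using L by (simp add: compact_metric_def L' homeomorphic_compact_space)
  have le: "GH_dist (X n) L' \<le> GH_dist (X n) L" for n
    unfolding GH_dist_def[of "X n" L]
  proof (rule cInf_greatest)
    have "mspace (X n) \<noteq> {}" "mspace L \<noteq> {}"
      using X[of n] L by (simp_all add: compact_metric_def)
    then obtain Z :: "('b + 'c) metric" and f g where
      "isometric_embedding (X n) Z f" "isometric_embedding L Z g"
      using common_metric_space_exists[of "X n" L] by metis
    then show "{hausdorff_dist Z (f ` mspace (X n)) (g ` mspace L) | (Z :: ('b + 'c) metric) f g.
            isometric_embedding (X n) Z f \<and> isometric_embedding L Z g} \<noteq> {}"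
      by blast
    fix t assume "t \<in> {hausdorff_dist Z (f ` mspace (X n)) (g ` mspace L) | (Z :: ('b + 'c) metric) f g.
            isometric_embedding (X n) Z f \<and> isometric_embedding L Z g}"
    then obtain Z :: "('b + 'c) metric" and f g where
      t: "t = hausdorff_dist Z (f ` mspace (X n)) (g ` mspace L)"
      and f: "isometric_embedding (X n) Z f" and g: "isometric_embedding L Z g" by blast
    have "isometric_embedding L' Z (g \<circ> k)"
      using g by (auto simp: isometric_embedding_def L' kh)
    moreover have "(g \<circ> k) ` mspace L' = g ` mspace L"
      by (force simp: L' kh)
    ultimately show "GH_dist (X n) L' \<le> t"
      using GH_dist_le[OF X cL' f, of "g \<circ> k"] t by simp
  qed
  have "(\<lambda>n. GH_dist (X n) L') \<longlonglongrightarrow> 0"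
    by (rule tendsto_sandwich[OF _ _ tendsto_const lim])
       (auto simp: le GH_dist_nonneg[OF X cL'])
  then show ?thesis
    using X cL' by (auto simp: GH_convergent_def GH_converges_to_def)
qed


section \<open>The normalized metric on residue classes\<close>

text \<open>
  The points of \<open>\<int>/p\<int>\<close> are the residue classes themselves, i.e. the elements of the carrier of
  \<^const>\<open>ZFact\<close>, which are sets of integers.
\<close>

definition residue_rep :: "nat \<Rightarrow> int set \<Rightarrow> int" where
  "residue_rep p A = (THE n. n \<in> A \<and> 0 \<le> n \<and> n \<le> int p - 1)"

definition residue_dist :: "nat \<Rightarrow> int set \<Rightarrow> int set \<Rightarrow> real" where
  "residue_dist p A B = real_of_int \<bar>residue_rep p A - residue_rep p B\<bar>"

definition normalized_residue_dist :: "nat \<Rightarrow> int set \<Rightarrow> int set \<Rightarrow> real" where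
  "normalized_residue_dist p A B = 1 / (real p - 1) * residue_dist p A B"

definition normalized_residue_space :: "nat \<Rightarrow> int set metric" where
  "normalized_residue_space p = metric (carrier (ZFact (int p)), normalized_residue_dist p)"

lemma carrier_ZFact: "carrier (ZFact k) = range (\<lambda>n. {m. [m = n] (mod k)})"
proof -
  have "(\<Union>h\<in>Idl\<^bsub>\<Z>\<^esub> {k}. {h + n}) = {m. [m = n] (mod k)}" for n
    unfolding int_Idl cong_iff_dvd_diff
    by (auto simp: dvd_def) (metis diff_add_cancel mult.commute)
  then show ?thesis
    by (auto simp: ZFact_defs A_RCOSETS_defs r_coset_def)
qed

lemma residue_rep_class:
  assumes "p > 0"
  shows "residue_rep p {m. [m = n] (mod int p)} = n mod int p"
  unfolding residue_rep_def
proof (rule the_equality)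
  show "n mod int p \<in> {m. [m = n] (mod int p)} \<and> 0 \<le> n mod int p \<and> n mod int p \<le> int p - 1"
    using assms by simp
qed (auto simp: cong_def)

lemma Metric_space_normalized_residue_dist:
  assumes "p \<ge> 2"
  shows "Metric_space (carrier (ZFact (int p))) (normalized_residue_dist p)"
proof
  show "0 \<le> normalized_residue_dist p A B" for A B
    using assms by (simp add: normalized_residue_dist_def residue_dist_def)
  show "normalized_residue_dist p A B = normalized_residue_dist p B A" for A B
    by (simp add: normalized_residue_dist_def residue_dist_def abs_minus_commute)
  show "normalized_residue_dist p A B = 0 \<longleftrightarrow> A = B"
    if AB: "A \<in> carrier (ZFact (int p))" "B \<in> carrier (ZFact (int p))" for A B
  proof -
    obtain m n where "A = {k. [k = m] (mod int p)}" "B = {k. [k = n] (mod int p)}"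
      using AB unfolding carrier_ZFact by blast
    moreover from this have "A = B \<longleftrightarrow> m mod int p = n mod int p"
      by (auto simp: cong_def set_eq_iff)
    ultimately show ?thesis
      using assms by (simp add: normalized_residue_dist_def residue_dist_def residue_rep_class)
  qed
  show "normalized_residue_dist p A C \<le> normalized_residue_dist p A B + normalized_residue_dist p B C"
    for A B C
    unfolding normalized_residue_dist_def residue_dist_def distrib_left[symmetric]
    using assms by (intro mult_left_mono) auto
qed

lemma mspace_normalized_residue_space:
  "p \<ge> 2 \<Longrightarrow> mspace (normalized_residue_space p) = carrier (ZFact (int p))"
  by (simp add: normalized_residue_space_def Metric_space.mspace_metric
      Metric_space_normalized_residue_dist)

lemma mdist_normalized_residue_space:
  "p \<ge> 2 \<Longrightarrow> mdist (normalized_residue_space p) = normalized_residue_dist p"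
  by (simp add: normalized_residue_space_def Metric_space.mdist_metric
      Metric_space_normalized_residue_dist)

lemma compact_metric_normalized_residue_space:
  assumes "p \<ge> 2"
  shows "compact_metric (normalized_residue_space p)"
proof -
  have "carrier (ZFact (int p)) \<subseteq> (\<lambda>n. {m. [m = n] (mod int p)}) ` {0..<int p}"
  proof
    fix A assume "A \<in> carrier (ZFact (int p))"
    then obtain n where "A = {m. [m = n] (mod int p)}"
      unfolding carrier_ZFact by blast
    then have "A = {m. [m = n mod int p] (mod int p)}"
      by (simp add: cong_def)
    moreover have "n mod int p \<in> {0..<int p}"
      using assms by simp
    ultimately show "A \<in> (\<lambda>n. {m. [m = n] (mod int p)}) ` {0..<int p}"
      by blast
  qed
  then have "finite (carrier (ZFact (int p)))"
    using finite_subset by blast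
  then have "finite (mspace (normalized_residue_space p))"
    using assms by (simp add: mspace_normalized_residue_space)
  moreover have "mspace (normalized_residue_space p) \<noteq> {}"
    using assms by (simp add: mspace_normalized_residue_space carrier_ZFact)
  ultimately show ?thesis
    by (simp add: compact_metric_def compact_space_def finite_imp_compactin)
qed

end

theory Submission
  imports Defs "HOL-Real_Asymp.Real_Asymp"
begin

text \<open>
  Sending a class with representative \<open>n\<close> to \<open>n / (p - 1)\<close> embeds the normalized residue space
  isometrically onto a grid of mesh \<open>1 / (p - 1)\<close> in the unit interval, which contains both end
  points. So the spaces converge to the unit interval along the whole sequence of primes.
\<close>

lemma hausdorff_dist_le:
  assumes "0 < r" "A \<subseteq> (\<Union>b\<in>B. mball_of Z b r)" "B \<subseteq> (\<Union>a\<in>A. mball_of Z a r)"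
  shows "hausdorff_dist Z A B \<le> r"
  unfolding hausdorff_dist_def
  by (rule cInf_lower) (use assms in \<open>auto intro: bdd_belowI[of _ 0]\<close>)

text \<open>Taken as a subspace of the real line, so that \<open>id\<close> embeds it isometrically
  into the space that also receives the residue classes.\<close>

definition unit_interval_metric :: "real metric" where
  "unit_interval_metric = submetric euclidean_metric {0..1}"

lemma mspace_unit_interval_metric [simp]: "mspace unit_interval_metric = {0..1}"
  by (simp add: unit_interval_metric_def mspace_submetric)

lemma mdist_unit_interval_metric [simp]: "mdist unit_interval_metric = dist"
  by (simp add: unit_interval_metric_def)

lemma compact_metric_unit_interval: "compact_metric unit_interval_metric"
  by (simp add: compact_metric_def unit_interval_metric_def mtopology_of_submetric
      mspace_submetric compact_space_subtopology)

text \<open>Dividing by \<open>p - 1\<close>, the largest representative, sends the last class to 1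
  and matches the normalizing factor of the metric.\<close>

definition residue_position :: "nat \<Rightarrow> int set \<Rightarrow> real" where
  "residue_position p A = real_of_int (residue_rep p A) / (real p - 1)"

text \<open>\<open>carrier_ZFact\<close> indexes the classes by all integers, with repetition. The
  position of the class of \<open>n\<close> depends only on \<open>n mod int p\<close>, and these
  remainders fill \<open>{0..int p - 1}\<close>.\<close>

lemma residue_position_image:
  assumes "p \<ge> 2"
  shows "residue_position p ` carrier (ZFact (int p)) =
           (\<lambda>n. real_of_int n / (real p - 1)) ` {0..int p - 1}"
proof -
  have "range (\<lambda>n. n mod int p) = {0..int p - 1}"
  proof
    show "range (\<lambda>n. n mod int p) \<subseteq> {0..int p - 1}"
      using assms by auto
    show "{0..int p - 1} \<subseteq> range (\<lambda>n. n mod int p)"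
    proof
      fix n assume "n \<in> {0..int p - 1}"
      then have "n = n mod int p" by simp
      then show "n \<in> range (\<lambda>n. n mod int p)" by blast
    qed
  qed
  then show ?thesis
    using assms
    by (simp add: carrier_ZFact residue_position_def residue_rep_class image_image
        flip: image_image[of "\<lambda>n. real_of_int n / (real p - 1)" "\<lambda>n. n mod int p"])
qed

lemma isometric_embedding_residue_position:
  assumes "p \<ge> 2"
  shows "isometric_embedding (normalized_residue_space p) euclidean_metric (residue_position p)"
  using assms
  by (simp add: isometric_embedding_def mspace_normalized_residue_space
      mdist_normalized_residue_space normalized_residue_dist_def residue_dist_def
      residue_position_def dist_real_def abs_divide flip: diff_divide_distrib)

text \<open>Both spaces embed in the real line, so by \<open>GH_dist_le\<close> their Hausdorff
  distance there is an upper bound.\<close>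

lemma GH_dist_normalized_residue_space_le:
  assumes p: "p \<ge> 2"
  shows "GH_dist (normalized_residue_space p) unit_interval_metric \<le> 2 / (real p - 1)"
proof -
  let ?q = "real p - 1"
  let ?grid = "(\<lambda>n. real_of_int n / ?q) ` {0..int p - 1}"
  have q: "?q > 0" using p by simp
  have "GH_dist (normalized_residue_space p) unit_interval_metric \<le>
          hausdorff_dist euclidean_metric
            (residue_position p ` mspace (normalized_residue_space p))
            (id ` mspace unit_interval_metric)"
    by (intro GH_dist_le compact_metric_normalized_residue_space compact_metric_unit_interval
        isometric_embedding_residue_position p) (simp add: isometric_embedding_def)
  also have "\<dots> = hausdorff_dist euclidean_metric ?grid {0..1}"
    using p by (simp add: mspace_normalized_residue_space residue_position_image)
  also have "\<dots> \<le> 2 / ?q"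
  proof (rule hausdorff_dist_le)
    show "0 < 2 / ?q" using q by simp
    \<comment> \<open>Each grid point is thus itself the centre of one of the balls.\<close>
    have "?grid \<subseteq> {0..1}" using q by (auto simp: divide_le_eq)
    then show "?grid \<subseteq> (\<Union>t\<in>{0..1}. mball_of euclidean_metric t (2 / ?q))"
      using q by force
    show "{0..1} \<subseteq> (\<Union>x\<in>?grid. mball_of euclidean_metric x (2 / ?q))"
    proof
      fix t :: real assume t: "t \<in> {0..1}"
      \<comment> \<open>\<open>n / ?q\<close> is the last grid point not to the right of
        \<open>t\<close>. It is less than \<open>1 / ?q\<close> away, so the radius
        \<open>2 / ?q\<close> leaves slack.\<close>
      define n where "n = \<lfloor>t * ?q\<rfloor>"
      have n: "n \<le> t * ?q" "t * ?q < n + 1" by (simp_all add: n_def)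
      \<comment> \<open>Since \<open>?q\<close> is \<open>p - 1\<close>, this keeps \<open>n\<close>
        among the grid indices, even at \<open>t = 1\<close>.\<close>
      have "t * ?q \<le> ?q" using t q by (simp add: mult_left_le_one_le)
      then have "n \<le> int p - 1" using n by linarith
      moreover have "n \<ge> 0" using t q by (simp add: n_def)
      ultimately have "n \<in> {0..int p - 1}" by simp
      moreover have "\<bar>n / ?q - t\<bar> < 2 / ?q"
      proof -
        have "\<bar>n / ?q - t\<bar> = \<bar>n - t * ?q\<bar> / ?q"
          using q by (simp add: abs_div_pos diff_divide_distrib)
        also have "\<dots> < 2 / ?q"
          using n q by (intro divide_strict_right_mono) linarith+
        finally show ?thesis .
      qed
      ultimately show "t \<in> (\<Union>x\<in>?grid. mball_of euclidean_metric x (2 / ?q))"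
        by (auto simp: dist_real_def)
    qed
  qed
  finally show ?thesis .
qed

text \<open>A strictly increasing sequence of naturals tends to infinity, so the distance is
  squeezed between 0 and \<open>2 / (real (p n) - 1)\<close>. Primality plays no part in this
  estimate.\<close>

lemma GH_converges_to_unit_interval:
  fixes p :: "nat \<Rightarrow> nat"
  assumes mono: "strict_mono p" and p: "\<And>n. p n \<ge> 2"
  shows "GH_converges_to (\<lambda>n. normalized_residue_space (p n)) unit_interval_metric"
proof -
  have "(\<lambda>m. 2 / (real m - 1)) \<longlonglongrightarrow> 0" by real_asymp
  then have lim: "(\<lambda>n. 2 / (real (p n) - 1)) \<longlonglongrightarrow> 0"
    using filterlim_compose[OF _ filterlim_subseq[OF mono]] by blast
  have "(\<lambda>n. GH_dist (normalized_residue_space (p n)) unit_interval_metric) \<longlonglongrightarrow> 0"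
    by (rule tendsto_sandwich[OF _ _ tendsto_const lim])
       (auto intro!: always_eventually GH_dist_normalized_residue_space_le GH_dist_nonneg
         compact_metric_normalized_residue_space compact_metric_unit_interval p)
  then show ?thesis
    by (simp add: GH_converges_to_def compact_metric_normalized_residue_space
        compact_metric_unit_interval p)
qed

theorem theorem3p8:
  shows "\<exists>p :: nat \<Rightarrow> nat. strict_mono p \<and> (\<forall>n. Factorial_Ring.prime (p n)) \<and>
           GH_convergent (\<lambda>n. normalized_residue_space (p n))"
proof (intro exI conjI allI)
  \<comment> \<open>The subsequence chosen is the sequence of all primes in increasing order; the
    set being infinite makes \<open>enumerate\<close> strictly monotone.\<close>
  let ?P = "{p :: nat. Factorial_Ring.prime p}"
  show mono: "strict_mono (enumerate ?P)"
    using primes_infinite by (rule strict_mono_enumerate)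
  show prime: "Factorial_Ring.prime (enumerate ?P n)" for n
    using enumerate_in_set[OF primes_infinite] by simp
  show "GH_convergent (\<lambda>n. normalized_residue_space (enumerate ?P n))"
    by (rule GH_convergentI[OF GH_converges_to_unit_interval[OF mono prime_ge_2_nat[OF prime]]])
qed

end
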